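(* Let $p\ge1$ be an integer and let $(a_n^{(k)})_{n\in\mathbb{Z}}$, $0\le k\le p$, be bounded sequences of complex numbers. Let $\mathcal{M}$ be the associated two-sided operator on $\ell^2(\mathbb{Z})$ and, for $j\in\mathbb{Z}$, let $$w_j(z)=\frac{1}{z-a_j^{(0)}-\sum_{\ell=1}^p\sum_{k=0}^{\ell}a_{j-k}^{(\ell)}\,\phi_{j,\ell-k}^{+}(z)\,\phi_{j,k}^{-}(z)}.$$ Then for all $j\in\mathbb{Z}$, $$w_j(z)=\langle(zI-\mathcal{M})^{-1}\hat e_j,\hat e_j\rangle,\qquad |z|>\|\mathcal{M}\|.$$
   Context: $\{\hat e_n\}_{n\in\mathbb{Z}}$ and $\{e_n\}_{n\ge1}$ are the standard orthonormal bases of $\ell^2(\mathbb{Z})$ and $\ell^2(\mathbb{N})$. $\mathcal{M}$ is the bounded operator on $\ell^2(\mathbb{Z})$ with $\mathcal{M}\hat e_n=\hat e_{n-1}+\sum_{k=0}^p a_n^{(k)}\hat e_{n+k}$, $n\in\mathbb{Z}$. For $r\in\mathbb{Z}$, $\mathcal{H}_r^{+}$ and $\mathcal{H}_r^{-}$ are the bounded operators on $\ell^2(\mathbb{N})$ defined by $\mathcal{H}_r^+e_1=\sum_{k=0}^p a_{r+1}^{(k)}e_{k+1}$, $\mathcal{H}_r^+e_n=e_{n-1}+\sum_{k=0}^p a_{n+r}^{(k)}e_{n+k}$ for $n\ge2$, and $\mathcal{H}_r^-e_1=\sum_{k=0}^p a_{r-1-k}^{(k)}e_{k+1}$, $\mathcal{H}_r^-e_n=e_{n-1}+\sum_{k=0}^p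 a_{r-n-k}^{(k)}e_{n+k}$ for $n\ge2$. Their resolvent functions are $\phi_{r,k}^{\pm}(z)=\langle(zI-\mathcal{H}_r^{\pm})^{-1}e_k,e_1\rangle$, $1\le k\le p$, and $\phi_{r,0}^{\pm}\equiv1$. *)

theory Defs
  imports "HOL-Analysis.Analysis"
begin

section \<open>The complex Hilbert space of square-summable families\<close>

typedef 'i ell2 = "{x :: 'i \<Rightarrow> complex. (\<lambda>i. (cmod (x i))\<^sup>2) summable_on UNIV}"
  morphisms coord Abs_ell2
  by (rule exI[of _ "\<lambda>_. 0"]) simp

setup_lifting type_definition_ell2

lemma ell2_eqI: "(\<And>i. coord x i = coord y i) \<Longrightarrow> x = y"
  by (auto simp: coord_inject[symmetric])

lemma square_summable_coord: "(\<lambda>i. (cmod (coord x i))\<^sup>2) summable_on UNIV"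
  using coord[of x] by simp

lemma square_summable_add:
  fixes x y :: "'i \<Rightarrow> complex"
  assumes "(\<lambda>i. (cmod (x i))\<^sup>2) summable_on UNIV" "(\<lambda>i. (cmod (y i))\<^sup>2) summable_on UNIV"
  shows "(\<lambda>i. (cmod (x i + y i))\<^sup>2) summable_on UNIV"
proof (rule summable_on_comparison_test)
  show "(\<lambda>i. 2 * (cmod (x i))\<^sup>2 + 2 * (cmod (y i))\<^sup>2) summable_on UNIV"
    by (intro summable_on_add summable_on_cmult_right assms)
  fix i
  have "(cmod (x i + y i))\<^sup>2 \<le> (cmod (x i) + cmod (y i))\<^sup>2"
    by (intro power_mono norm_triangle_ineq) auto
  also have "\<dots> \<le> 2 * (cmod (x i))\<^sup>2 + 2 * (cmod (y i))\<^sup>2"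
    using zero_le_power2[of "cmod (x i) - cmod (y i)"]
    by (simp add: power2_eq_square algebra_simps)
  finally show "(cmod (x i + y i))\<^sup>2 \<le> 2 * (cmod (x i))\<^sup>2 + 2 * (cmod (y i))\<^sup>2" .
qed auto

lemma square_summable_mult:
  fixes x :: "'i \<Rightarrow> complex"
  assumes "(\<lambda>i. (cmod (x i))\<^sup>2) summable_on UNIV"
  shows "(\<lambda>i. (cmod (c * x i))\<^sup>2) summable_on UNIV"
  using summable_on_cmult_right[OF assms, of "(cmod c)\<^sup>2"]
  by (simp add: norm_mult power_mult_distrib)

lemma abs_summable_mult_coord: "(\<lambda>i. norm (coord x i * cnj (coord y i))) summable_on UNIV"
  by (rule abs_summable_product)
     (use square_summable_coord[of x] square_summable_coord[of y]
      in \<open>simp_all add: norm_mult power2_eq_square\<close>)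

lemma summable_mult_coord: "(\<lambda>i. coord x i * cnj (coord y i)) summable_on UNIV"
  by (rule abs_summable_summable) (rule abs_summable_mult_coord)

lemma summable_inner_coord: "(\<lambda>i. inner (coord x i) (coord y i)) summable_on UNIV"
  using summable_on_Re[OF summable_mult_coord[of x y]]
  by (simp add: inner_complex_def)

instantiation ell2 :: (type) real_inner
begin

lift_definition zero_ell2 :: "'a ell2" is "\<lambda>_. 0" by simp

lift_definition plus_ell2 :: "'a ell2 \<Rightarrow> 'a ell2 \<Rightarrow> 'a ell2" is "\<lambda>x y i. x i + y i"
  by (rule square_summable_add)

lift_definition uminus_ell2 :: "'a ell2 \<Rightarrow> 'a ell2" is "\<lambda>x i. - x i" by simp

lift_definition minus_ell2 :: "'a ell2 \<Rightarrow> 'a ell2 \<Rightarrow> 'a ell2" is "\<lambda>x y i. x i - y i"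
  subgoal for x y using square_summable_add[of x "\<lambda>i. - y i"] by simp
  done

lift_definition scaleR_ell2 :: "real \<Rightarrow> 'a ell2 \<Rightarrow> 'a ell2" is "\<lambda>r x i. complex_of_real r * x i"
  by (rule square_summable_mult)

definition inner_ell2 :: "'a ell2 \<Rightarrow> 'a ell2 \<Rightarrow> real" where
  "inner_ell2 x y = (\<Sum>\<^sub>\<infinity>i. inner (coord x i) (coord y i))"

definition norm_ell2 :: "'a ell2 \<Rightarrow> real" where
  "norm_ell2 x = sqrt (\<Sum>\<^sub>\<infinity>i. (cmod (coord x i))\<^sup>2)"

definition dist_ell2 :: "'a ell2 \<Rightarrow> 'a ell2 \<Rightarrow> real" where
  "dist_ell2 x y = norm (x - y)"

definition sgn_ell2 :: "'a ell2 \<Rightarrow> 'a ell2" where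
  "sgn_ell2 x = scaleR (inverse (norm x)) x"

definition uniformity_ell2 :: "('a ell2 \<times> 'a ell2) filter" where
  "uniformity_ell2 = (INF e\<in>{0<..}. principal {(x, y). dist x y < e})"

definition open_ell2 :: "'a ell2 set \<Rightarrow> bool" where
  "open_ell2 U \<longleftrightarrow> (\<forall>x\<in>U. eventually (\<lambda>(x', y). x' = x \<longrightarrow> y \<in> U) uniformity)"

instance
proof
  fix x y z :: "'a ell2" and r s :: real
  show "x + y + z = x + (y + z)" by transfer (simp add: add.assoc)
  show "x + y = y + x" by transfer (simp add: add.commute)
  show "0 + x = x" by transfer simp
  show "- x + x = 0" by transfer simp
  show "x - y = x + - y" by transfer simp
  show "r *\<^sub>R (x + y) = r *\<^sub>R x + r *\<^sub>R y" by transfer (simp add: algebra_simps)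
  show "(r + s) *\<^sub>R x = r *\<^sub>R x + s *\<^sub>R x" by transfer (simp add: algebra_simps)
  show "r *\<^sub>R s *\<^sub>R x = (r * s) *\<^sub>R x" by transfer (simp add: algebra_simps)
  show "1 *\<^sub>R x = x" by transfer simp
  show "dist x y = norm (x - y)" by (simp add: dist_ell2_def)
  show "sgn x = inverse (norm x) *\<^sub>R x" by (simp add: sgn_ell2_def)
  show "uniformity = (INF e\<in>{0<..}. principal {(x :: 'a ell2, y). dist x y < e})"
    by (simp add: uniformity_ell2_def)
  show "open U \<longleftrightarrow> (\<forall>x\<in>U. eventually (\<lambda>(x', y). x' = x \<longrightarrow> y \<in> U) uniformity)" for U :: "'a ell2 set"
    by (simp add: open_ell2_def)
  show "inner x y = inner y x" by (simp add: inner_ell2_def inner_commute)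
  show "inner (x + y) z = inner x z + inner y z"
    by (simp add: inner_ell2_def plus_ell2.rep_eq inner_add_left infsum_add summable_inner_coord)
  show "inner (r *\<^sub>R x) y = r * inner x y"
    by (simp add: inner_ell2_def scaleR_ell2.rep_eq flip: scaleR_conv_of_real infsum_cmult_right')
  show "0 \<le> inner x x"
    by (simp add: inner_ell2_def infsum_nonneg)
  have "coord x i = 0" if "inner x x = 0" for i
  proof -
    have "inner (coord x i) (coord x i) = 0"
      by (rule nonneg_infsum_le_0D[of "\<lambda>i. inner (coord x i) (coord x i)" UNIV])
         (use that summable_inner_coord[of x x] in \<open>auto simp: inner_ell2_def\<close>)
    then show ?thesis by simp
  qed
  moreover have "inner x x = 0" if "x = 0"
    using that by (simp add: inner_ell2_def zero_ell2.rep_eq)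
  ultimately show "inner x x = 0 \<longleftrightarrow> x = 0"
    by (auto intro!: ell2_eqI simp: zero_ell2.rep_eq)
  show "norm x = sqrt (inner x x)"
    by (simp add: norm_ell2_def inner_ell2_def flip: power2_norm_eq_inner)
qed

end

lemma coord_simps [simp]:
  "coord 0 i = 0"
  "coord (x + y) i = coord x i + coord y i"
  "coord (- x) i = - coord x i"
  "coord (x - y) i = coord x i - coord y i"
  "coord (r *\<^sub>R x) i = complex_of_real r * coord x i"
  by (simp_all add: zero_ell2.rep_eq plus_ell2.rep_eq uminus_ell2.rep_eq minus_ell2.rep_eq
      scaleR_ell2.rep_eq)

lemma coord_sum [simp]: "coord (sum f A) i = (\<Sum>k\<in>A. coord (f k) i)"
  by (induction A rule: infinite_finite_induct) simp_all

lemma norm_ell2_power2: "(norm x)\<^sup>2 = (\<Sum>\<^sub>\<infinity>i. (cmod (coord x i))\<^sup>2)"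
  by (simp add: norm_ell2_def infsum_nonneg)

lemma sum_coord_le: "finite F \<Longrightarrow> (\<Sum>i\<in>F. (cmod (coord x i))\<^sup>2) \<le> (norm x)\<^sup>2"
  unfolding norm_ell2_power2 by (rule finite_sum_le_infsum) (auto simp: square_summable_coord)

lemma cmod_coord_le: "cmod (coord x i) \<le> norm x"
  using sum_coord_le[of "{i}" x] by (simp add: power2_le_iff_abs_le)

lemma ell2_of_finite_bound:
  assumes "\<And>F. finite F \<Longrightarrow> (\<Sum>i\<in>F. (cmod (f i))\<^sup>2) \<le> B\<^sup>2" and "0 \<le> B"
  obtains x where "coord x = f" and "norm x \<le> B"
proof -
  have s: "(\<lambda>i. (cmod (f i))\<^sup>2) summable_on UNIV"
    by (rule nonneg_bdd_above_summable_on) (auto intro!: bdd_aboveI2 assms)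
  then have c: "coord (Abs_ell2 f) = f" by (simp add: Abs_ell2_inverse)
  have "(norm (Abs_ell2 f))\<^sup>2 \<le> B\<^sup>2"
    unfolding norm_ell2_power2 c by (rule infsum_le_finite_sums[OF s]) (rule assms)
  then show ?thesis using that[of "Abs_ell2 f"] c assms(2) by (simp add: power2_le_iff_abs_le)
qed

instance ell2 :: (type) banach
proof
  fix X :: "nat \<Rightarrow> 'a ell2"
  assume C: "Cauchy X"
  have "Cauchy (\<lambda>n. coord (X n) i)" for i
  proof (rule metric_CauchyI)
    fix e :: real assume "0 < e"
    then obtain N where N: "\<And>m n. m \<ge> N \<Longrightarrow> n \<ge> N \<Longrightarrow> dist (X m) (X n) < e"
      using metric_CauchyD[OF C] by blast
    have "dist (coord (X m) i) (coord (X n) i) \<le> dist (X m) (X n)" for m n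
      using cmod_coord_le[of "X m - X n" i] by (simp add: dist_norm)
    then show "\<exists>N. \<forall>m\<ge>N. \<forall>n\<ge>N. dist (coord (X m) i) (coord (X n) i) < e"
      using N by (meson le_less_trans)
  qed
  then have lim: "(\<lambda>n. coord (X n) i) \<longlonglongrightarrow> lim (\<lambda>n. coord (X n) i)" for i
    by (simp add: Cauchy_convergent_iff convergent_LIMSEQ_iff)
  define l where "l = (\<lambda>i. lim (\<lambda>n. coord (X n) i))"
  have l: "(\<lambda>n. coord (X n) i) \<longlonglongrightarrow> l i" for i
    unfolding l_def by (rule lim)
  have tail: "(\<Sum>i\<in>F. (cmod (l i - coord (X n) i))\<^sup>2) \<le> e\<^sup>2"
    if "\<And>m n. m \<ge> N \<Longrightarrow> n \<ge> N \<Longrightarrow> dist (X m) (X n) < e" "n \<ge> N" "finite F" for e N n F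
  proof (rule tendsto_upperbound)
    show "(\<lambda>m. \<Sum>i\<in>F. (cmod (coord (X m) i - coord (X n) i))\<^sup>2)
        \<longlonglongrightarrow> (\<Sum>i\<in>F. (cmod (l i - coord (X n) i))\<^sup>2)"
      by (intro tendsto_intros l)
    have "(\<Sum>i\<in>F. (cmod (coord (X m) i - coord (X n) i))\<^sup>2) \<le> e\<^sup>2" if "m \<ge> N" for m
    proof -
      have "(\<Sum>i\<in>F. (cmod (coord (X m) i - coord (X n) i))\<^sup>2) \<le> (norm (X m - X n))\<^sup>2"
        using sum_coord_le[OF \<open>finite F\<close>, of "X m - X n"] by simp
      also have "\<dots> \<le> e\<^sup>2"
        using that \<open>\<And>m n. m \<ge> N \<Longrightarrow> n \<ge> N \<Longrightarrow> dist (X m) (X n) < e\<close>[of m n] \<open>n \<ge> N\<close>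
        by (intro power_mono) (auto simp: dist_norm)
      finally show ?thesis .
    qed
    then show "\<forall>\<^sub>F m in sequentially. (\<Sum>i\<in>F. (cmod (coord (X m) i - coord (X n) i))\<^sup>2) \<le> e\<^sup>2"
      by (auto simp: eventually_sequentially)
  qed simp
  have close: "\<exists>d. coord d = (\<lambda>i. l i - coord (X n) i) \<and> norm d \<le> e"
    if "0 < e" "\<forall>m\<ge>N. \<forall>n\<ge>N. dist (X m) (X n) < e" "n \<ge> N" for e N n
  proof -
    have "(\<Sum>i\<in>F. (cmod (l i - coord (X n) i))\<^sup>2) \<le> e\<^sup>2" if "finite F" for F
      by (rule tail[of N]) (use that \<open>\<forall>m\<ge>N. \<forall>n\<ge>N. dist (X m) (X n) < e\<close> \<open>n \<ge> N\<close> in auto)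
    then show ?thesis
      using ell2_of_finite_bound[of "\<lambda>i. l i - coord (X n) i" e] \<open>0 < e\<close> by auto
  qed
  obtain N1 where N1: "\<forall>m\<ge>N1. \<forall>n\<ge>N1. dist (X m) (X n) < 1"
    using metric_CauchyD[OF C, of 1] by auto
  obtain d where d: "coord d = (\<lambda>i. l i - coord (X N1) i)"
    using close[OF zero_less_one N1, of N1] by blast
  define L where "L = d + X N1"
  have L: "coord L i = l i" for i by (simp add: L_def d)
  have "X \<longlonglongrightarrow> L"
  proof (rule metric_LIMSEQ_I)
    fix e :: real assume "0 < e"
    then obtain N where N: "\<forall>m\<ge>N. \<forall>n\<ge>N. dist (X m) (X n) < e / 2"
      using metric_CauchyD[OF C, of "e / 2"] by auto
    have "dist (X n) L < e" if n: "n \<ge> N" for n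
    proof -
      obtain d where d: "coord d = (\<lambda>i. l i - coord (X n) i)" "norm d \<le> e / 2"
        using close[of "e / 2", OF _ N n] \<open>0 < e\<close> by auto
      have "L - X n = d" by (rule ell2_eqI) (simp add: L d)
      then show ?thesis using d(2) \<open>0 < e\<close> by (simp add: dist_norm norm_minus_commute[of "X n" L])
    qed
    then show "\<exists>N. \<forall>n\<ge>N. dist (X n) L < e" by blast
  qed
  then show "convergent X" by (auto simp: convergent_def)
qed

lift_definition scaleC :: "complex \<Rightarrow> 'i ell2 \<Rightarrow> 'i ell2" (infixr "*\<^sub>C" 75) is "\<lambda>c x i. c * x i"
  by (rule square_summable_mult)

definition cinner :: "'i ell2 \<Rightarrow> 'i ell2 \<Rightarrow> complex" where
  "cinner x y = (\<Sum>\<^sub>\<infinity>i. coord x i * cnj (coord y i))"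

lift_definition unit :: "'i \<Rightarrow> 'i ell2" is "\<lambda>n i. if i = n then 1 else 0"
  by (rule finite_nonzero_values_imp_summable_on) simp

lemma coord_scaleC [simp]: "coord (c *\<^sub>C x) i = c * coord x i"
  by (simp add: scaleC.rep_eq)

lemma coord_unit: "coord (unit n) i = (if i = n then 1 else 0)"
  by (simp add: unit.rep_eq)

lemma Re_cinner: "Re (cinner x y) = inner x y"
  by (simp add: cinner_def inner_ell2_def inner_complex_def flip: infsum_Re[OF summable_mult_coord])

lemma norm_scaleC: "norm (c *\<^sub>C x) = cmod c * norm x"
  by (simp add: norm_ell2_def norm_mult power_mult_distrib infsum_cmult_right' real_sqrt_mult)

lemma bounded_linear_scaleC: "bounded_linear (\<lambda>x. c *\<^sub>C x)"
  by (rule bounded_linear_intro[where K = "cmod c"])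
     (auto intro!: ell2_eqI simp: algebra_simps norm_scaleC)

section \<open>Bounded operators\<close>

text \<open>The type \<open>\<Rightarrow>\<^sub>L\<close> consists of the bounded \<open>\<real>\<close>-linear maps, so complex homogeneity is
  required separately.  The operator norm does not depend on the scalar field, and a bounded
  inverse of a complex linear map is complex linear.\<close>

definition complex_linear :: "('i ell2 \<Rightarrow>\<^sub>L 'j ell2) \<Rightarrow> bool" where
  "complex_linear T \<longleftrightarrow> (\<forall>c x. T (c *\<^sub>C x) = c *\<^sub>C T x)"

lift_definition scalar_op :: "complex \<Rightarrow> 'i ell2 \<Rightarrow>\<^sub>L 'i ell2" is "\<lambda>z x. z *\<^sub>C x"
  by (rule bounded_linear_scaleC)

text \<open>Meaningful only when \<open>zI - T\<close> has a bounded two-sided inverse, which is then unique.\<close>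

definition resolvent :: "('i ell2 \<Rightarrow>\<^sub>L 'i ell2) \<Rightarrow> complex \<Rightarrow> 'i ell2 \<Rightarrow>\<^sub>L 'i ell2" where
  "resolvent T z = (THE R. (scalar_op z - T) o\<^sub>L R = id_blinfun \<and> R o\<^sub>L (scalar_op z - T) = id_blinfun)"

lemma resolvent_eqI:
  assumes "(scalar_op z - T) o\<^sub>L R = id_blinfun" "R o\<^sub>L (scalar_op z - T) = id_blinfun"
  shows "resolvent T z = R"
  unfolding resolvent_def
proof (rule the_equality)
  fix R' assume "(scalar_op z - T) o\<^sub>L R' = id_blinfun \<and> R' o\<^sub>L (scalar_op z - T) = id_blinfun"
  then have *: "(scalar_op z - T) o\<^sub>L R' = id_blinfun" by simp
  have "R' = (R o\<^sub>L (scalar_op z - T)) o\<^sub>L R'"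
    unfolding assms(2) by (rule blinfun_eqI) simp
  also have "\<dots> = R o\<^sub>L ((scalar_op z - T) o\<^sub>L R')"
    by (rule blinfun_eqI) simp
  also have "\<dots> = R"
    unfolding * by (rule blinfun_eqI) simp
  finally show "R' = R" .
qed (use assms in simp)

lemma has_sum_unit: "((\<lambda>i. coord x i *\<^sub>C unit i) has_sum x) UNIV"
proof -
  have co: "coord (x - (\<Sum>j\<in>F. coord x j *\<^sub>C unit j)) i = (if i \<in> F then 0 else coord x i)"
    if "finite F" for F i
    using that by (simp add: coord_unit if_distrib[of "\<lambda>t. _ * t"] sum.delta' cong: if_cong)
  have nr: "(norm (x - (\<Sum>j\<in>F. coord x j *\<^sub>C unit j)))\<^sup>2
      = (norm x)\<^sup>2 - (\<Sum>i\<in>F. (cmod (coord x i))\<^sup>2)" if "finite F" for F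
  proof -
    have "(norm (x - (\<Sum>j\<in>F. coord x j *\<^sub>C unit j)))\<^sup>2 = (\<Sum>\<^sub>\<infinity>i. if i \<in> F then 0 else (cmod (coord x i))\<^sup>2)"
      unfolding norm_ell2_power2 co[OF that] by (rule infsum_cong) auto
    also have "\<dots> = infsum (\<lambda>i. (cmod (coord x i))\<^sup>2) (UNIV - F)"
      by (rule infsum_cong_neutral) auto
    also have "\<dots> = (norm x)\<^sup>2 - (\<Sum>i\<in>F. (cmod (coord x i))\<^sup>2)"
      using infsum_Diff[OF square_summable_coord[of x], of F] that by (simp add: norm_ell2_power2)
    finally show ?thesis .
  qed
  have "((\<lambda>F. \<Sum>i\<in>F. (cmod (coord x i))\<^sup>2) \<longlongrightarrow> (norm x)\<^sup>2) (finite_subsets_at_top UNIV)"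
    using has_sum_infsum[OF square_summable_coord[of x]] by (simp add: has_sum_def norm_ell2_power2)
  then have "((\<lambda>F. sqrt ((norm x)\<^sup>2 - (\<Sum>i\<in>F. (cmod (coord x i))\<^sup>2))) \<longlongrightarrow> sqrt ((norm x)\<^sup>2 - (norm x)\<^sup>2))
      (finite_subsets_at_top UNIV)"
    by (intro tendsto_intros)
  moreover have "\<forall>\<^sub>F F in finite_subsets_at_top UNIV.
        sqrt ((norm x)\<^sup>2 - (\<Sum>i\<in>F. (cmod (coord x i))\<^sup>2)) = norm (x - (\<Sum>j\<in>F. coord x j *\<^sub>C unit j))"
    by (rule eventually_finite_subsets_at_top_weakI) (simp flip: nr)
  ultimately have "((\<lambda>F. norm (x - (\<Sum>j\<in>F. coord x j *\<^sub>C unit j))) \<longlongrightarrow> sqrt ((norm x)\<^sup>2 - (norm x)\<^sup>2))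
      (finite_subsets_at_top UNIV)"
    by (rule Lim_transform_eventually)
  then have "((\<lambda>F. norm ((\<Sum>j\<in>F. coord x j *\<^sub>C unit j) - x)) \<longlongrightarrow> 0) (finite_subsets_at_top UNIV)"
    by (simp add: norm_minus_commute)
  then show ?thesis
    unfolding has_sum_def by (simp add: LIM_zero_iff tendsto_norm_zero_iff)
qed

lemma blinfun_eq_on_units:
  assumes "complex_linear S" "complex_linear T" "\<And>i. S (unit i) = T (unit i)"
  shows "S = T"
proof (rule blinfun_eqI)
  fix x
  have "((\<lambda>i. S (coord x i *\<^sub>C unit i)) has_sum S x) UNIV" "((\<lambda>i. T (coord x i *\<^sub>C unit i)) has_sum T x) UNIV"
    by (rule has_sum_bounded_linear[OF blinfun.bounded_linear_right has_sum_unit])+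
  moreover have "S (coord x i *\<^sub>C unit i) = T (coord x i *\<^sub>C unit i)" for i
    using assms by (simp add: complex_linear_def)
  ultimately show "S x = T x" using has_sum_unique by auto
qed

lemma weighted_shift:
  fixes w :: "'i \<Rightarrow> complex" and g :: "'i \<Rightarrow> 'i"
  assumes "inj_on g {i. w i \<noteq> 0}" and "bounded (range w)"
  obtains T :: "'i ell2 \<Rightarrow>\<^sub>L 'i ell2" where
    "complex_linear T" and "\<And>x i. coord (T x) i = w i * coord x (g i)"
proof -
  obtain B where B: "0 < B" "\<And>i. cmod (w i) \<le> B"
    using assms(2) by (auto simp: bounded_pos)
  have fb: "(\<Sum>i\<in>F. (cmod (w i * coord x (g i)))\<^sup>2) \<le> (B * norm x)\<^sup>2" if "finite F" for F x
  proof -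
    define G where "G = F \<inter> {i. w i \<noteq> 0}"
    have "(\<Sum>i\<in>F. (cmod (w i * coord x (g i)))\<^sup>2) = (\<Sum>i\<in>G. (cmod (w i * coord x (g i)))\<^sup>2)"
      using that by (intro sum.mono_neutral_right) (auto simp: G_def)
    also have "\<dots> \<le> (\<Sum>i\<in>G. B\<^sup>2 * (cmod (coord x (g i)))\<^sup>2)"
      by (intro sum_mono) (simp add: norm_mult power_mult_distrib mult_right_mono power_mono B)
    also have "\<dots> = B\<^sup>2 * (\<Sum>i\<in>g ` G. (cmod (coord x i))\<^sup>2)"
      using inj_on_subset[OF assms(1), of G] by (simp add: sum.reindex sum_distrib_left G_def)
    also have "\<dots> \<le> B\<^sup>2 * (norm x)\<^sup>2"
      using that by (intro mult_left_mono sum_coord_le) (auto simp: G_def)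
    finally show ?thesis by (simp add: power_mult_distrib)
  qed
  have "\<exists>y. coord y = (\<lambda>i. w i * coord x (g i)) \<and> norm y \<le> B * norm x" for x
    using ell2_of_finite_bound[OF fb, of x] B(1) by auto
  then have "\<exists>f. \<forall>x. coord (f x) = (\<lambda>i. w i * coord x (g i)) \<and> norm (f x) \<le> B * norm x"
    by (intro choice allI)
  then obtain f where f: "\<And>x. coord (f x) = (\<lambda>i. w i * coord x (g i))" "\<And>x. norm (f x) \<le> B * norm x"
    by blast
  have "bounded_linear f"
    by (rule bounded_linear_intro[where K = B])
       (auto intro!: ell2_eqI simp: f algebra_simps mult.commute[of _ B])
  then have bf: "blinfun_apply (Blinfun f) = f" by (rule bounded_linear_Blinfun_apply)
  have "complex_linear (Blinfun f)"
    unfolding complex_linear_def bf by (auto intro!: ell2_eqI simp: f)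
  then show ?thesis by (rule that) (simp add: bf f)
qed

lemma banded_op:
  fixes w :: "nat \<Rightarrow> 'i \<Rightarrow> complex" and v :: "'i \<Rightarrow> complex" and g :: "nat \<Rightarrow> 'i \<Rightarrow> 'i"
  assumes "inj h" and "\<And>k. k \<le> p \<Longrightarrow> inj_on (g k) {i. w k i \<noteq> 0}"
    and "\<And>k. k \<le> p \<Longrightarrow> bounded (range (w k))"
  shows "\<exists>T :: 'i ell2 \<Rightarrow>\<^sub>L 'i ell2. complex_linear T \<and>
    (\<forall>x i. coord (T x) i = coord x (h i) + (\<Sum>k=0..p. w k i * coord x (g k i)))"
proof -
  have "bounded (range (\<lambda>_::'i. 1::complex))" "inj_on h {i. (1::complex) \<noteq> 0}"
    using assms(1) by (auto intro: bounded_subset[of "{1}"])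
  then obtain S :: "'i ell2 \<Rightarrow>\<^sub>L 'i ell2" where
    S: "complex_linear S" "\<And>x i. coord (S x) i = 1 * coord x (h i)"
    using weighted_shift[of h "\<lambda>_. 1"] by blast
  have "\<exists>T :: 'i ell2 \<Rightarrow>\<^sub>L 'i ell2. k \<le> p \<longrightarrow> complex_linear T \<and> (\<forall>x i. coord (T x) i = w k i * coord x (g k i))" for k
    using weighted_shift[of "g k" "w k"] assms(2,3) by metis
  then obtain T :: "nat \<Rightarrow> 'i ell2 \<Rightarrow>\<^sub>L 'i ell2" where
    T: "\<And>k. k \<le> p \<Longrightarrow> complex_linear (T k)" "\<And>k x i. k \<le> p \<Longrightarrow> coord (T k x) i = w k i * coord x (g k i)"
    by metis
  have *: "coord ((S + (\<Sum>k=0..p. T k)) x) i = coord x (h i) + (\<Sum>k=0..p. w k i * coord x (g k i))" for x i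
    by (simp add: blinfun.add_left blinfun.sum_left S T)
  moreover have "complex_linear (S + (\<Sum>k=0..p. T k))"
    unfolding complex_linear_def
    by (auto intro!: ell2_eqI simp: * algebra_simps sum_distrib_left)
  ultimately show ?thesis by blast
qed

section \<open>The banded operators\<close>

text \<open>Throughout, \<open>a k n\<close> stands for $a_n^{(k)}$.  For bounded sequences each of the operators
  below is the unique bounded one with the prescribed action on the standard basis; see the lemmas
  \<open>two_sided_op\<close>, \<open>plus_op\<close>, \<open>minus_op\<close>.\<close>

definition is_two_sided :: "nat \<Rightarrow> (nat \<Rightarrow> int \<Rightarrow> complex) \<Rightarrow> (int ell2 \<Rightarrow>\<^sub>L int ell2) \<Rightarrow> bool" where
  "is_two_sided p a T \<longleftrightarrow> complex_linear T \<and>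
     (\<forall>n. T (unit n) = unit (n - 1) + (\<Sum>k=0..p. a k n *\<^sub>C unit (n + int k)))"

definition two_sided_op :: "nat \<Rightarrow> (nat \<Rightarrow> int \<Rightarrow> complex) \<Rightarrow> int ell2 \<Rightarrow>\<^sub>L int ell2" where
  "two_sided_op p a = (THE T. is_two_sided p a T)"

text \<open>The standard basis of $\ell^2(\mathbb{N})$ is indexed by $n \ge 1$; the argument \<open>0\<close> is
  never used.\<close>

definition basis :: "nat \<Rightarrow> nat ell2" where
  "basis n = unit (n - 1)"

definition is_plus :: "nat \<Rightarrow> (nat \<Rightarrow> int \<Rightarrow> complex) \<Rightarrow> int \<Rightarrow> (nat ell2 \<Rightarrow>\<^sub>L nat ell2) \<Rightarrow> bool" where
  "is_plus p a r T \<longleftrightarrow> complex_linear T \<and>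
     T (basis 1) = (\<Sum>k=0..p. a k (r + 1) *\<^sub>C basis (k + 1)) \<and>
     (\<forall>n\<ge>2. T (basis n) = basis (n - 1) + (\<Sum>k=0..p. a k (int n + r) *\<^sub>C basis (n + k)))"

definition is_minus :: "nat \<Rightarrow> (nat \<Rightarrow> int \<Rightarrow> complex) \<Rightarrow> int \<Rightarrow> (nat ell2 \<Rightarrow>\<^sub>L nat ell2) \<Rightarrow> bool" where
  "is_minus p a r T \<longleftrightarrow> complex_linear T \<and>
     T (basis 1) = (\<Sum>k=0..p. a k (r - 1 - int k) *\<^sub>C basis (k + 1)) \<and>
     (\<forall>n\<ge>2. T (basis n) = basis (n - 1) + (\<Sum>k=0..p. a k (r - int n - int k) *\<^sub>C basis (n + k)))"

definition plus_op :: "nat \<Rightarrow> (nat \<Rightarrow> int \<Rightarrow> complex) \<Rightarrow> int \<Rightarrow> nat ell2 \<Rightarrow>\<^sub>L nat ell2" where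
  "plus_op p a r = (THE T. is_plus p a r T)"

definition minus_op :: "nat \<Rightarrow> (nat \<Rightarrow> int \<Rightarrow> complex) \<Rightarrow> int \<Rightarrow> nat ell2 \<Rightarrow>\<^sub>L nat ell2" where
  "minus_op p a r = (THE T. is_minus p a r T)"

lemma two_sided_op:
  assumes "\<forall>k\<le>p. bounded (range (a k))"
  shows "is_two_sided p a (two_sided_op p a)"
proof -
  have "bounded (range (\<lambda>i. a k (i - int k)))" if "k \<le> p" for k
    by (rule bounded_subset[of "range (a k)"]) (use assms that in auto)
  then have "\<exists>T :: int ell2 \<Rightarrow>\<^sub>L int ell2. complex_linear T \<and>
    (\<forall>x i. coord (T x) i = coord x (i + 1) + (\<Sum>k=0..p. a k (i - int k) * coord x (i - int k)))"
    by (intro banded_op[of "\<lambda>i. i + 1" p "\<lambda>k i. i - int k" "\<lambda>k i. a k (i - int k)"])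
       (auto simp: inj_on_def)
  then obtain T :: "int ell2 \<Rightarrow>\<^sub>L int ell2" where T: "complex_linear T"
    "\<And>x i. coord (T x) i = coord x (i + 1) + (\<Sum>k=0..p. a k (i - int k) * coord x (i - int k))"
    by blast
  have "T (unit n) = unit (n - 1) + (\<Sum>k=0..p. a k n *\<^sub>C unit (n + int k))" for n
  proof (rule ell2_eqI)
    fix i
    have "coord (unit n) (i + 1) = coord (unit (n - 1)) i"
      by (auto simp: coord_unit)
    moreover have "a k (i - int k) * coord (unit n) (i - int k) = a k n * coord (unit (n + int k)) i" for k
      by (auto simp: coord_unit)
    ultimately show "coord (T (unit n)) i = coord (unit (n - 1) + (\<Sum>k=0..p. a k n *\<^sub>C unit (n + int k))) i"
      by (simp add: T(2))
  qed
  then have "is_two_sided p a T"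
    using T(1) by (simp add: is_two_sided_def)
  moreover have "T' = T" if "is_two_sided p a T'" for T'
    using that \<open>is_two_sided p a T\<close> by (intro blinfun_eq_on_units) (simp_all add: is_two_sided_def)
  ultimately show ?thesis unfolding two_sided_op_def by (rule theI)
qed

lemma ex_one_sided:
  fixes c :: "nat \<Rightarrow> nat \<Rightarrow> complex"
  assumes "\<And>k. k \<le> p \<Longrightarrow> bounded (range (c k))"
  shows "\<exists>T. complex_linear T \<and> T (basis 1) = (\<Sum>k=0..p. c k 1 *\<^sub>C basis (k + 1)) \<and>
    (\<forall>n\<ge>2. T (basis n) = basis (n - 1) + (\<Sum>k=0..p. c k n *\<^sub>C basis (n + k)))"
proof -
  have "inj_on (\<lambda>i. i - k) {i. (if k \<le> i then c k (i - k + 1) else 0) \<noteq> 0}" for k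
    by (auto simp: inj_on_def split: if_splits)
  moreover have "bounded (range (\<lambda>i. if k \<le> i then c k (i - k + 1) else 0))" if "k \<le> p" for k
    by (rule bounded_subset[of "insert 0 (range (c k))"]) (use assms that in auto)
  ultimately have "\<exists>T :: nat ell2 \<Rightarrow>\<^sub>L nat ell2. complex_linear T \<and>
    (\<forall>x i. coord (T x) i = coord x (Suc i)
       + (\<Sum>k=0..p. (if k \<le> i then c k (i - k + 1) else 0) * coord x (i - k)))"
    by (intro banded_op[of Suc p "\<lambda>k i. i - k" "\<lambda>k i. if k \<le> i then c k (i - k + 1) else 0"])
       simp_all
  then obtain T :: "nat ell2 \<Rightarrow>\<^sub>L nat ell2" where T: "complex_linear T"
    "\<And>x i. coord (T x) i = coord x (Suc i)
       + (\<Sum>k=0..p. (if k \<le> i then c k (i - k + 1) else 0) * coord x (i - k))"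
    by blast
  show ?thesis
  proof (intro exI[of _ T] conjI allI impI)
    have *: "(if k \<le> i then c k (i - k + 1) else 0) * coord (unit n) (i - k)
        = c k (Suc n) * coord (unit (n + k)) i" for k i n
      by (auto simp: coord_unit)
    show "T (basis 1) = (\<Sum>k=0..p. c k 1 *\<^sub>C basis (k + 1))"
    proof (rule ell2_eqI)
      fix i
      show "coord (T (basis 1)) i = coord (\<Sum>k=0..p. c k 1 *\<^sub>C basis (k + 1)) i"
        using *[of _ i 0] by (simp add: T(2) basis_def coord_unit[of 0 "Suc i"])
    qed
    show "T (basis n) = basis (n - 1) + (\<Sum>k=0..p. c k n *\<^sub>C basis (n + k))" if n: "n \<ge> 2" for n
    proof (rule ell2_eqI)
      fix i
      obtain m where m: "n = Suc (Suc m)"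
        using n by (metis add_2_eq_Suc le_Suc_ex)
      have "coord (unit (Suc m)) (Suc i) = coord (unit m) i"
        by (simp add: coord_unit)
      then show "coord (T (basis n)) i = coord (basis (n - 1) + (\<Sum>k=0..p. c k n *\<^sub>C basis (n + k))) i"
        using *[of _ i "Suc m"] by (simp add: T(2) basis_def m)
    qed
  qed (rule T(1))
qed

lemma one_sided_unique:
  assumes "complex_linear S" "complex_linear T" "S (basis 1) = T (basis 1)"
    and "\<And>n. n \<ge> 2 \<Longrightarrow> S (basis n) = T (basis n)"
  shows "S = T"
proof (rule blinfun_eq_on_units)
  fix i
  show "S (unit i) = T (unit i)"
    using assms(3) assms(4)[of "Suc i"] by (cases i) (auto simp: basis_def)
qed (use assms in auto)

lemma plus_op:
  assumes "\<forall>k\<le>p. bounded (range (a k))"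
  shows "is_plus p a r (plus_op p a r)"
proof -
  have "bounded (range (\<lambda>n. a k (int n + r)))" if "k \<le> p" for k
    by (rule bounded_subset[of "range (a k)"]) (use assms that in auto)
  from ex_one_sided[of p "\<lambda>k n. a k (int n + r)", OF this] obtain T where "is_plus p a r T"
    unfolding is_plus_def by (auto simp: add.commute)
  moreover have "T' = T" if "is_plus p a r T'" for T'
    using that \<open>is_plus p a r T\<close> by (intro one_sided_unique) (auto simp: is_plus_def)
  ultimately show ?thesis unfolding plus_op_def by (rule theI)
qed

lemma minus_op:
  assumes "\<forall>k\<le>p. bounded (range (a k))"
  shows "is_minus p a r (minus_op p a r)"
proof -
  have "bounded (range (\<lambda>n. a k (r - int n - int k)))" if "k \<le> p" for k
    by (rule bounded_subset[of "range (a k)"]) (use assms that in auto)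
  from ex_one_sided[of p "\<lambda>k n. a k (r - int n - int k)", OF this] obtain T where "is_minus p a r T"
    unfolding is_minus_def by (auto simp: add.commute)
  moreover have "T' = T" if "is_minus p a r T'" for T'
    using that \<open>is_minus p a r T\<close> by (intro one_sided_unique) (auto simp: is_minus_def)
  ultimately show ?thesis unfolding minus_op_def by (rule theI)
qed

section \<open>Resolvent functions\<close>

definition phi_plus :: "nat \<Rightarrow> (nat \<Rightarrow> int \<Rightarrow> complex) \<Rightarrow> int \<Rightarrow> nat \<Rightarrow> complex \<Rightarrow> complex" where
  "phi_plus p a r k z =
     (if k = 0 then 1 else cinner (resolvent (plus_op p a r) z (basis k)) (basis 1))"

definition phi_minus :: "nat \<Rightarrow> (nat \<Rightarrow> int \<Rightarrow> complex) \<Rightarrow> int \<Rightarrow> nat \<Rightarrow> complex \<Rightarrow> complex" where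
  "phi_minus p a r k z =
     (if k = 0 then 1 else cinner (resolvent (minus_op p a r) z (basis k)) (basis 1))"

text \<open>Since \<open>1 / 0 = 0\<close>, a claim about \<open>w_fun\<close> has its intended meaning only together
  with \<open>w_denom p a j z \<noteq> 0\<close>.\<close>

definition w_denom :: "nat \<Rightarrow> (nat \<Rightarrow> int \<Rightarrow> complex) \<Rightarrow> int \<Rightarrow> complex \<Rightarrow> complex" where
  "w_denom p a j z = z - a 0 j -
     (\<Sum>l=1..p. \<Sum>k=0..l. a l (j - int k) * phi_plus p a j (l - k) z * phi_minus p a j k z)"

definition w_fun :: "nat \<Rightarrow> (nat \<Rightarrow> int \<Rightarrow> complex) \<Rightarrow> int \<Rightarrow> complex \<Rightarrow> complex" where
  "w_fun p a j z = 1 / w_denom p a j z"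

end

theory Submission
  imports Defs
begin

text \<open>Let \<open>u = (zI - M)\<^sup>-\<^sup>1 e\<^sub>j\<close>, so that \<open>u\<^sub>j\<close> is the diagonal resolvent entry in question.
  The proof eliminates from \<open>(zI - M) u = e\<^sub>j\<close> the unknowns to the left and to the right of \<open>j\<close>
  (a Schur complement), which leaves a single scalar equation for \<open>u\<^sub>j\<close>.

  In coordinates, row \<open>i\<close> reads \<open>z u\<^sub>i = u\<^bsub>i+1\<^esub> + \<Sum>\<^sub>k a k (i - k) u\<^bsub>i-k\<^esub> + \<delta>\<^bsub>ij\<^esub>\<close>: a row sees only one
  entry to its right.  Hence the rows \<open>i < j\<close> form a closed system whose only source is \<open>u\<^sub>j\<close>,
  entering row \<open>j - 1\<close>.  The matrix of that system is the transpose of \<open>minus_op\<close>, so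
  \<open>u\<^bsub>j-k\<^esub> = u\<^sub>j \<phi>\<^sup>-\<^sub>k\<close>, a first row of a resolvent becoming a first column (\<open>left_half\<close>).
  The rows \<open>i > j\<close> form the system with matrix \<open>plus_op\<close>, driven by the finitely many entries
  \<open>u\<^bsub>j-k\<^esub>\<close>, \<open>0 \<le> k < p\<close>, and the first coordinate of its solution expresses \<open>u\<^bsub>j+1\<^esub>\<close> by these
  entries and the \<open>\<phi>\<^sup>+\<^sub>k\<close> (\<open>right_half\<close>).  Substituting both into row \<open>j\<close> turns it into \<open>u\<^sub>j w_denom = 1\<close>,
  which gives at once that the denominator does not vanish and that \<open>u\<^sub>j\<close> is its reciprocal.

  All resolvents involved exist for \<open>\<bar>z\<bar> > \<parallel>M\<parallel>\<close>: the one-sided operators are a compression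
  of \<open>M\<close> and a transpose of a compression of \<open>M\<close>, so their norms are at most \<open>\<parallel>M\<parallel>\<close>
  (\<open>norm_plus_le\<close>, \<open>norm_minus_le\<close>).\<close>

section \<open>Functionals on the sequence space\<close>

lemma cinner_unit: "cinner x (unit i) = coord x i"
proof -
  have "cinner x (unit i) = (\<Sum>\<^sub>\<infinity>k\<in>{i}. coord x k * cnj (coord (unit i) k))"
    unfolding cinner_def by (rule infsum_cong_neutral) (auto simp: coord_unit)
  then show ?thesis by (simp add: coord_unit)
qed

lemma cinner_unit_left: "cinner (unit i) y = cnj (coord y i)"
proof -
  have "cinner (unit i) y = (\<Sum>\<^sub>\<infinity>k\<in>{i}. coord (unit i) k * cnj (coord y k))"
    unfolding cinner_def by (rule infsum_cong_neutral) (auto simp: coord_unit)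
  then show ?thesis by (simp add: coord_unit)
qed

lemma cinner_add_left: "cinner (x + x') y = cinner x y + cinner x' y"
  by (simp add: cinner_def distrib_right infsum_add summable_mult_coord)

lemma cinner_scaleC_left: "cinner (c *\<^sub>C x) y = c * cinner x y"
  by (simp add: cinner_def mult.assoc infsum_cmult_right')

lemma bounded_linear_coord: "bounded_linear (\<lambda>x. coord x i)"
  by (rule bounded_linear_intro[where K = 1]) (auto simp: cmod_coord_le scaleR_conv_of_real)

lemma bounded_linear_cinner_left: "bounded_linear (\<lambda>x. cinner x y)"
  \<comment> \<open>The factor 2 comes from bounding the real and the imaginary part separately.\<close>
proof (rule bounded_linear_intro[where K = "2 * norm y"])
  show "cinner (x + x') y = cinner x y + cinner x' y" for x x'
    by (rule cinner_add_left)
  show "cinner (r *\<^sub>R x) y = r *\<^sub>R cinner x y" for r x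
  proof -
    have "r *\<^sub>R x = complex_of_real r *\<^sub>C x" by (rule ell2_eqI) simp
    then show ?thesis by (simp add: cinner_scaleC_left scaleR_conv_of_real)
  qed
  show "cmod (cinner x y) \<le> norm x * (2 * norm y)" for x
  proof -
    have re: "\<bar>Re (cinner x y)\<bar> \<le> norm x * norm y"
      using Cauchy_Schwarz_ineq2[of x y] by (simp add: Re_cinner)
    have "Im (cinner x y) = Re (cinner ((-\<i>) *\<^sub>C x) y)"
      by (simp only: cinner_scaleC_left) simp
    then have "\<bar>Im (cinner x y)\<bar> \<le> norm x * norm y"
      using Cauchy_Schwarz_ineq2[of "(-\<i>) *\<^sub>C x" y] by (simp add: Re_cinner norm_scaleC)
    with re show ?thesis
      using cmod_le[of "cinner x y"] by linarith
  qed
qed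

text \<open>A vector is the norm limit of its finite sections, so continuity reduces an identity
  between functionals to basis vectors.  Applied to coordinates of images, this turns the
  description of an operator by its columns into one by its rows.\<close>

lemma functional_eq_on_units:
  fixes f g :: "'i ell2 \<Rightarrow> complex"
  assumes "bounded_linear f" "bounded_linear g"
    and "\<And>c x. f (c *\<^sub>C x) = c * f x" "\<And>c x. g (c *\<^sub>C x) = c * g x"
    and "\<And>n. f (unit n) = g (unit n)"
  shows "f x = g x"
proof -
  have "((\<lambda>i. f (coord x i *\<^sub>C unit i)) has_sum f x) UNIV"
    "((\<lambda>i. g (coord x i *\<^sub>C unit i)) has_sum g x) UNIV"
    by (rule has_sum_bounded_linear[OF _ has_sum_unit], rule assms)+
  then show ?thesis
    using assms(3-5) has_sum_unique by auto
qed

text \<open>Supplies the restrictions of a two-sided vector to the half-lines, with or without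
  conjugation.\<close>

lemma ell2_dominated:
  assumes "inj g" "\<And>n. cmod (f n) \<le> cmod (coord x (g n))"
  obtains y where "coord y = f"
proof -
  have "(\<Sum>n\<in>F. (cmod (f n))\<^sup>2) \<le> (norm x)\<^sup>2" if "finite F" for F
  proof -
    have "(\<Sum>n\<in>F. (cmod (f n))\<^sup>2) \<le> (\<Sum>n\<in>F. (cmod (coord x (g n)))\<^sup>2)"
      by (intro sum_mono power_mono assms) simp
    also have "\<dots> = (\<Sum>n\<in>g ` F. (cmod (coord x n))\<^sup>2)"
      using inj_on_subset[OF assms(1)] by (simp add: sum.reindex)
    also have "\<dots> \<le> (norm x)\<^sup>2"
      using that by (intro sum_coord_le) simp
    finally show ?thesis .
  qed
  then show ?thesis
    using ell2_of_finite_bound[of f "norm x"] that by auto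
qed

section \<open>Operator norms of compressions and of their transposes\<close>

definition entry :: "('i ell2 \<Rightarrow>\<^sub>L 'j ell2) \<Rightarrow> 'j \<Rightarrow> 'i \<Rightarrow> complex" where
  "entry T m n = coord (T (unit n)) m"

lemma norm_finite_combination:
  assumes "finite F" "inj g"
  shows "norm (\<Sum>n\<in>F. c n *\<^sub>C unit (g n)) = L2_set (\<lambda>n. cmod (c n)) F"
proof -
  let ?y = "\<Sum>n\<in>F. c n *\<^sub>C unit (g n)"
  have at: "coord ?y (g n) = (if n \<in> F then c n else 0)" for n
    using assms by (simp add: coord_unit inj_eq if_distrib[of "\<lambda>t. _ * t"] sum.delta' cong: if_cong)
  have off: "coord ?y i = 0" if "i \<notin> g ` F" for i
    using that by (auto simp: coord_unit intro!: sum.neutral)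
  have "(norm ?y)\<^sup>2 = (\<Sum>\<^sub>\<infinity>i\<in>g ` F. (cmod (coord ?y i))\<^sup>2)"
    unfolding norm_ell2_power2 by (rule infsum_cong_neutral) (use off in auto)
  also have "\<dots> = (\<Sum>n\<in>F. (cmod (coord ?y (g n)))\<^sup>2)"
    using assms inj_on_subset[OF assms(2)] by (simp add: sum.reindex)
  also have "\<dots> = (\<Sum>n\<in>F. (cmod (c n))\<^sup>2)"
    using at by simp
  finally show ?thesis
    by (simp add: L2_set_def flip: real_sqrt_unique)
qed

text \<open>Selecting rows and columns along injections does not increase the bilinear form, because
  it only restricts the test vectors; the estimate is Cauchy-Schwarz for \<open>T y\<close> against \<open>d\<close>.\<close>

lemma bilinear_form_le_norm:
  fixes T :: "'i ell2 \<Rightarrow>\<^sub>L 'j ell2"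
  assumes "complex_linear T" "finite F" "finite G" "inj g" "inj h"
  shows "cmod (\<Sum>m\<in>G. \<Sum>n\<in>F. d m * (c n * entry T (h m) (g n)))
    \<le> norm T * L2_set (\<lambda>n. cmod (c n)) F * L2_set (\<lambda>m. cmod (d m)) G"
proof -
  define y where "y = (\<Sum>n\<in>F. c n *\<^sub>C unit (g n))"
  have Ty: "coord (T y) i = (\<Sum>n\<in>F. c n * entry T i (g n))" for i
    using assms(1) by (simp add: y_def blinfun.sum_right complex_linear_def entry_def)
  have "(L2_set (\<lambda>m. cmod (coord (T y) (h m))) G)\<^sup>2 = (\<Sum>i\<in>h ` G. (cmod (coord (T y) i))\<^sup>2)"
    using inj_on_subset[OF assms(5)] by (simp add: L2_set_def sum_nonneg sum.reindex)
  also have "\<dots> \<le> (norm (T y))\<^sup>2"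
    using assms by (intro sum_coord_le) simp
  finally have "L2_set (\<lambda>m. cmod (coord (T y) (h m))) G \<le> norm (T y)"
    by (rule power2_le_imp_le) simp
  also have "\<dots> \<le> norm T * norm y" by (rule norm_blinfun)
  finally have b: "L2_set (\<lambda>m. cmod (coord (T y) (h m))) G \<le> norm T * norm y" .
  have "cmod (\<Sum>m\<in>G. \<Sum>n\<in>F. d m * (c n * entry T (h m) (g n)))
      = cmod (\<Sum>m\<in>G. d m * coord (T y) (h m))"
    by (simp add: Ty sum_distrib_left)
  also have "\<dots> \<le> (\<Sum>m\<in>G. \<bar>cmod (d m)\<bar> * \<bar>cmod (coord (T y) (h m))\<bar>)"
    by (rule sum_norm_le) (simp add: norm_mult)
  also have "\<dots> \<le> L2_set (\<lambda>m. cmod (d m)) G * L2_set (\<lambda>m. cmod (coord (T y) (h m))) G"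
    by (rule L2_set_mult_ineq)
  also have "\<dots> \<le> L2_set (\<lambda>m. cmod (d m)) G * (norm T * norm y)"
    by (intro mult_left_mono b) simp
  finally show ?thesis
    using norm_finite_combination[OF assms(2,4)] by (simp add: y_def mult_ac)
qed

text \<open>Finitely supported vectors are dense, so it suffices to bound \<open>A\<close> on them.  On them the
  bound comes from the finite bilinear forms by testing against the conjugate of the image.
  The hypothesis is symmetric in rows and columns, which is why it
  serves transposes as well.\<close>

lemma norm_le_of_bilinear_form:
  fixes A :: "'i ell2 \<Rightarrow>\<^sub>L 'j ell2"
  assumes "complex_linear A" "0 \<le> K"
    and form: "\<And>F G c d. finite F \<Longrightarrow> finite G \<Longrightarrow>
      cmod (\<Sum>m\<in>G. \<Sum>n\<in>F. d m * (c n * entry A m n))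
        \<le> K * L2_set (\<lambda>n. cmod (c n)) F * L2_set (\<lambda>m. cmod (d m)) G"
  shows "norm A \<le> K"
proof (rule norm_blinfun_bound[OF assms(2)])
  fix x :: "'i ell2"
  have fin: "norm (A (\<Sum>n\<in>F. c n *\<^sub>C unit n)) \<le> K * norm (\<Sum>n\<in>F. c n *\<^sub>C unit n)"
    if F: "finite F" for F and c :: "'i \<Rightarrow> complex"
  proof -
    define v where "v = A (\<Sum>n\<in>F. c n *\<^sub>C unit n)"
    define N where "N = L2_set (\<lambda>n. cmod (c n)) F"
    have v: "coord v m = (\<Sum>n\<in>F. c n * entry A m n)" for m
      using assms(1) by (simp add: v_def blinfun.sum_right complex_linear_def entry_def)
    have "(\<Sum>m\<in>G. (cmod (coord v m))\<^sup>2) \<le> (K * N)\<^sup>2" if G: "finite G" for G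
    proof -
      define L where "L = L2_set (\<lambda>m. cmod (coord v m)) G"
      have L: "L\<^sup>2 = (\<Sum>m\<in>G. (cmod (coord v m))\<^sup>2)" "0 \<le> L"
        by (simp_all add: L_def L2_set_def sum_nonneg)
      have "complex_of_real (L\<^sup>2) = (\<Sum>m\<in>G. cnj (coord v m) * coord v m)"
        unfolding L(1) of_real_sum by (intro sum.cong refl) (metis complex_norm_square mult.commute)
      also have "\<dots> = (\<Sum>m\<in>G. \<Sum>n\<in>F. cnj (coord v m) * (c n * entry A m n))"
        by (subst (2) v) (simp add: sum_distrib_left)
      finally have "cmod (complex_of_real (L\<^sup>2)) \<le> K * N * L"
        using form[OF F G, of "\<lambda>m. cnj (coord v m)" c] by (simp add: N_def L_def)
      then have "L * L \<le> K * N * L"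
        by (simp only: norm_of_real) (simp add: power2_eq_square)
      then have "L \<le> K * N"
        using L(2) assms(2) by (cases "L = 0") (auto simp: N_def)
      then show ?thesis
        using L power_mono[of L "K * N" 2] by simp
    qed
    then obtain v' where "coord v' = coord v" "norm v' \<le> K * N"
      using ell2_of_finite_bound[of "coord v" "K * N"] assms(2) by (auto simp: N_def)
    then show ?thesis
      using norm_finite_combination[OF F, of id c] by (simp add: v_def N_def coord_inject)
  qed
  have lim: "((\<lambda>F. \<Sum>n\<in>F. coord x n *\<^sub>C unit n) \<longlongrightarrow> x) (finite_subsets_at_top UNIV)"
    using has_sum_unit[of x] by (simp add: has_sum_def)
  show "norm (A x) \<le> K * norm x"
  proof (rule tendsto_le)
    show "((\<lambda>F. K * norm (\<Sum>n\<in>F. coord x n *\<^sub>C unit n)) \<longlongrightarrow> K * norm x) (finite_subsets_at_top UNIV)"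
      by (intro tendsto_intros lim)
    show "((\<lambda>F. norm (A (\<Sum>n\<in>F. coord x n *\<^sub>C unit n))) \<longlongrightarrow> norm (A x)) (finite_subsets_at_top UNIV)"
      by (intro tendsto_intros lim)
    show "\<forall>\<^sub>F F in finite_subsets_at_top UNIV. norm (A (\<Sum>n\<in>F. coord x n *\<^sub>C unit n))
        \<le> K * norm (\<Sum>n\<in>F. coord x n *\<^sub>C unit n)"
      by (rule eventually_finite_subsets_at_top_weakI) (rule fin)
  qed simp
qed

lemma norm_compression_le:
  fixes A :: "'i ell2 \<Rightarrow>\<^sub>L 'i ell2" and T :: "'j ell2 \<Rightarrow>\<^sub>L 'j ell2"
  assumes "complex_linear A" "complex_linear T" "inj g"
    and "\<And>m n. entry A m n = entry T (g m) (g n)"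
  shows "norm A \<le> norm T"
  using assms bilinear_form_le_norm[OF assms(2) _ _ assms(3,3)]
  by (intro norm_le_of_bilinear_form) simp_all

lemma norm_transposed_compression_le:
  fixes A :: "'i ell2 \<Rightarrow>\<^sub>L 'i ell2" and T :: "'j ell2 \<Rightarrow>\<^sub>L 'j ell2"
  assumes "complex_linear A" "complex_linear T" "inj g"
    and "\<And>m n. entry A m n = entry T (g n) (g m)"
  shows "norm A \<le> norm T"
proof (rule norm_le_of_bilinear_form[OF assms(1)])
  fix F G :: "'i set" and c d :: "'i \<Rightarrow> complex"
  assume "finite F" "finite G"
  moreover have "(\<Sum>m\<in>G. \<Sum>n\<in>F. d m * (c n * entry A m n))
      = (\<Sum>n\<in>F. \<Sum>m\<in>G. c n * (d m * entry T (g n) (g m)))"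
    by (subst sum.swap) (simp add: assms(4) mult_ac)
  ultimately show "cmod (\<Sum>m\<in>G. \<Sum>n\<in>F. d m * (c n * entry A m n))
      \<le> norm T * L2_set (\<lambda>n. cmod (c n)) F * L2_set (\<lambda>m. cmod (d m)) G"
    using bilinear_form_le_norm[OF assms(2) _ _ assms(3,3), of G F c d] by (simp add: mult_ac)
qed simp

section \<open>Resolvents outside the disc of radius the norm\<close>

lemma scalar_op_minus_apply: "(scalar_op z - T) x = z *\<^sub>C x - T x"
  by (simp add: blinfun.diff_left scalar_op.rep_eq)

text \<open>For \<open>\<bar>z\<bar> > \<parallel>T\<parallel>\<close> the map \<open>x \<mapsto> z\<^sup>-\<^sup>1 (y + T x)\<close> is a contraction, whose fixed point
  is the solution of \<open>(zI - T) x = y\<close>; boundedness below makes the inverse bounded.\<close>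

lemma resolvent_inverse:
  fixes T :: "'i ell2 \<Rightarrow>\<^sub>L 'i ell2"
  assumes z: "norm T < cmod z"
  shows "(scalar_op z - T) (resolvent T z x) = x" "resolvent T z ((scalar_op z - T) x) = x"
proof -
  let ?S = "scalar_op z - T"
  have z0: "0 < cmod z" "z \<noteq> 0" using z norm_ge_zero[of T] by (linarith, force)
  have below: "(cmod z - norm T) * norm x \<le> norm (?S x)" for x
  proof -
    have "norm (z *\<^sub>C x) - norm (T x) \<le> norm (?S x)"
      unfolding scalar_op_minus_apply by (rule norm_triangle_ineq2)
    then show ?thesis
      using norm_blinfun[of T x] by (simp add: norm_scaleC algebra_simps)
  qed
  have inj: "x = y" if "?S x = ?S y" for x y
    using below[of "x - y"] that z by (simp add: blinfun.diff_right mult_le_0_iff)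
  have "\<exists>x. ?S x = y" for y
  proof -
    have "\<exists>!x. inverse z *\<^sub>C (y + T x) = x"
    proof (rule banach_fix_type[where c = "norm T / cmod z"])
      show "\<forall>u v. dist (inverse z *\<^sub>C (y + T u)) (inverse z *\<^sub>C (y + T v)) \<le> norm T / cmod z * dist u v"
      proof (intro allI)
        fix u v
        have "inverse z *\<^sub>C (y + T u) - inverse z *\<^sub>C (y + T v) = inverse z *\<^sub>C T (u - v)"
          by (rule ell2_eqI) (simp add: blinfun.diff_right algebra_simps)
        then have "dist (inverse z *\<^sub>C (y + T u)) (inverse z *\<^sub>C (y + T v)) = norm (T (u - v)) / cmod z"
          by (simp only: dist_norm norm_scaleC norm_inverse) (simp add: divide_inverse)
        then show "dist (inverse z *\<^sub>C (y + T u)) (inverse z *\<^sub>C (y + T v)) \<le> norm T / cmod z * dist u v"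
          using norm_blinfun[of T "u - v"] z0(1)
          by (simp add: dist_norm divide_right_mono)
      qed
    qed (use z z0 in auto)
    then obtain x where x: "inverse z *\<^sub>C (y + T x) = x" by blast
    have "?S x = z *\<^sub>C (inverse z *\<^sub>C (y + T x)) - T x"
      unfolding scalar_op_minus_apply x ..
    also have "\<dots> = y"
      by (rule ell2_eqI) (use z0 in \<open>simp flip: mult.assoc\<close>)
    finally show ?thesis by blast
  qed
  then obtain f where f: "\<And>y. ?S (f y) = y" by metis
  have f': "f (?S x) = x" for x by (rule inj) (rule f)
  have "bounded_linear f"
  proof (rule bounded_linear_intro[where K = "1 / (cmod z - norm T)"])
    show "f (x + y) = f x + f y" for x y
      by (rule inj) (simp add: f blinfun.add_right)
    show "f (r *\<^sub>R x) = r *\<^sub>R f x" for r x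
      by (rule inj) (simp add: f blinfun.scaleR_right)
    show "norm (f x) \<le> norm x * (1 / (cmod z - norm T))" for x
      using below[of "f x"] z by (simp add: f field_simps)
  qed
  then have B: "blinfun_apply (Blinfun f) = f" by (rule bounded_linear_Blinfun_apply)
  have "resolvent T z = Blinfun f"
    by (rule resolvent_eqI; rule blinfun_eqI) (simp_all add: B f f')
  with B show "?S (resolvent T z x) = x" "resolvent T z (?S x) = x"
    by (simp_all add: f f')
qed

lemma resolvent_scaleC:
  assumes "norm T < cmod z" "complex_linear T"
  shows "resolvent T z (c *\<^sub>C x) = c *\<^sub>C resolvent T z x"
proof -
  have "(scalar_op z - T) (c *\<^sub>C resolvent T z x) = c *\<^sub>C (scalar_op z - T) (resolvent T z x)"
    using assms(2) by (auto intro!: ell2_eqI simp: scalar_op_minus_apply complex_linear_def algebra_simps)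
  also have "\<dots> = c *\<^sub>C x" by (simp add: resolvent_inverse assms)
  finally show ?thesis by (metis resolvent_inverse(2)[OF assms(1)])
qed

section \<open>Rows and columns of the banded operators\<close>

lemma two_sided_entry:
  assumes "is_two_sided p a T"
  shows "entry T i n = (if i = n - 1 then 1 else 0) + (\<Sum>k=0..p. if i = n + int k then a k n else 0)"
  using assms by (simp add: is_two_sided_def entry_def coord_unit if_distrib[of "\<lambda>t. _ * t"] cong: if_cong)

lemma two_sided_row:
  assumes "is_two_sided p a T"
  shows "coord (T x) i = coord x (i + 1) + (\<Sum>k=0..p. a k (i - int k) * coord x (i - int k))"
proof (rule functional_eq_on_units[where f = "\<lambda>x. coord (T x) i"])
  show "bounded_linear (\<lambda>x. coord (T x) i)"
    by (rule bounded_linear_compose[OF bounded_linear_coord blinfun.bounded_linear_right])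
  show "bounded_linear (\<lambda>x. coord x (i + 1) + (\<Sum>k=0..p. a k (i - int k) * coord x (i - int k)))"
    by (intro bounded_linear_add bounded_linear_sum bounded_linear_const_mult bounded_linear_coord)
  show "coord (T (c *\<^sub>C x)) i = c * coord (T x) i" for c x
    using assms by (simp add: is_two_sided_def complex_linear_def)
  show "coord (T (unit n)) i = coord (unit n) (i + 1)
      + (\<Sum>k=0..p. a k (i - int k) * coord (unit n) (i - int k))" for n
    using two_sided_entry[OF assms, of i n]
    by (auto simp: entry_def coord_unit intro!: arg_cong2[where f = "(+)"] sum.cong)
qed (simp add: algebra_simps sum_distrib_left)

lemma plus_column:
  assumes "is_plus p a r T"
  shows "T (unit n) = (if n = 0 then 0 else unit (n - 1))
    + (\<Sum>k=0..p. a k (r + 1 + int n) *\<^sub>C unit (n + k))"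
proof (cases n)
  case 0
  then show ?thesis using assms by (simp add: is_plus_def basis_def)
next
  case (Suc m)
  then have "T (basis (Suc n)) = basis n + (\<Sum>k=0..p. a k (int (Suc n) + r) *\<^sub>C basis (Suc n + k))"
    using assms by (simp add: is_plus_def)
  then show ?thesis using Suc by (simp add: basis_def add_ac)
qed

lemma minus_column:
  assumes "is_minus p a r T"
  shows "T (unit n) = (if n = 0 then 0 else unit (n - 1))
    + (\<Sum>k=0..p. a k (r - 1 - int n - int k) *\<^sub>C unit (n + k))"
proof (cases n)
  case 0
  then show ?thesis using assms by (simp add: is_minus_def basis_def)
next
  case (Suc m)
  then have "T (basis (Suc n)) = basis n + (\<Sum>k=0..p. a k (r - int (Suc n) - int k) *\<^sub>C basis (Suc n + k))"
    using assms by (simp add: is_minus_def)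
  then show ?thesis using Suc by (simp add: basis_def algebra_simps)
qed

lemma plus_entry:
  assumes "is_plus p a r T"
  shows "entry T m n = (if n = m + 1 then 1 else 0)
    + (\<Sum>k=0..p. if m = n + k then a k (r + 1 + int n) else 0)"
proof -
  have "coord (if n = 0 then 0 else unit (n - 1)) m = (if n = m + 1 then 1 else 0)"
    by (auto simp: coord_unit)
  moreover have "coord (c *\<^sub>C unit (n + k)) m = (if m = n + k then c else 0)" for c k
    by (simp add: coord_unit)
  ultimately show ?thesis
    by (simp only: entry_def plus_column[OF assms] coord_simps(2) coord_sum)
qed

lemma minus_entry:
  assumes "is_minus p a r T"
  shows "entry T m n = (if n = m + 1 then 1 else 0)
    + (\<Sum>k=0..p. if m = n + k then a k (r - 1 - int m) else 0)"
proof -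
  have "coord (if n = 0 then 0 else unit (n - 1)) m = (if n = m + 1 then 1 else 0)"
    by (auto simp: coord_unit)
  moreover have "coord (a k (r - 1 - int n - int k) *\<^sub>C unit (n + k)) m
      = (if m = n + k then a k (r - 1 - int m) else 0)" for k
    by (simp add: coord_unit algebra_simps)
  ultimately show ?thesis
    by (simp only: entry_def minus_column[OF assms] coord_simps(2) coord_sum)
qed

lemma plus_row:
  assumes "is_plus p a r T"
  shows "coord (T x) i = coord x (i + 1)
    + (\<Sum>k=0..p. if k \<le> i then a k (r + 1 + int i - int k) * coord x (i - k) else 0)"
proof (rule functional_eq_on_units[where f = "\<lambda>x. coord (T x) i"])
  show "bounded_linear (\<lambda>x. coord (T x) i)"
    by (rule bounded_linear_compose[OF bounded_linear_coord blinfun.bounded_linear_right])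
  have "bounded_linear (\<lambda>x. if k \<le> i then a k (r + 1 + int i - int k) * coord x (i - k) else 0)" for k
    by (cases "k \<le> i") (simp_all add: bounded_linear_const_mult bounded_linear_coord)
  then show "bounded_linear (\<lambda>x. coord x (i + 1)
      + (\<Sum>k=0..p. if k \<le> i then a k (r + 1 + int i - int k) * coord x (i - k) else 0))"
    by (intro bounded_linear_add bounded_linear_sum bounded_linear_coord)
  show "coord (T (c *\<^sub>C x)) i = c * coord (T x) i" for c x
    using assms by (simp add: is_plus_def complex_linear_def)
  show "coord (T (unit n)) i = coord (unit n) (i + 1)
      + (\<Sum>k=0..p. if k \<le> i then a k (r + 1 + int i - int k) * coord (unit n) (i - k) else 0)" for n
    unfolding plus_entry[OF assms, unfolded entry_def]
    by (intro arg_cong2[where f = "(+)"] sum.cong refl) (auto simp: coord_unit add_ac)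
qed (auto simp: algebra_simps sum_distrib_left intro!: sum.cong)

lemma norm_plus_le:
  assumes "is_two_sided p a M" "is_plus p a r T"
  shows "norm T \<le> norm M"
proof (rule norm_compression_le[where g = "\<lambda>n. r + 1 + int n"])
  show "entry T m n = entry M (r + 1 + int m) (r + 1 + int n)" for m n
    unfolding two_sided_entry[OF assms(1)] plus_entry[OF assms(2)]
    by (intro arg_cong2[where f = "(+)"] sum.cong refl) auto
qed (use assms in \<open>auto simp: inj_on_def is_two_sided_def is_plus_def\<close>)

lemma norm_minus_le:
  assumes "is_two_sided p a M" "is_minus p a r T"
  shows "norm T \<le> norm M"
proof (rule norm_transposed_compression_le[where g = "\<lambda>n. r - 1 - int n"])
  show "entry T m n = entry M (r - 1 - int n) (r - 1 - int m)" for m n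
    unfolding two_sided_entry[OF assms(1)] minus_entry[OF assms(2)]
    by (intro arg_cong2[where f = "(+)"] sum.cong refl) auto
qed (use assms in \<open>auto simp: inj_on_def is_two_sided_def is_minus_def\<close>)

section \<open>Eliminating the two half-lines\<close>

text \<open>The hypothesis says that the reflected left half \<open>u\<^sub>-\<close> of \<open>u\<close> satisfies
  \<open>(zI - H)\<^sup>T u\<^sub>- = u\<^sub>j e\<^sub>1\<close>.  Paired with \<open>x = (zI - H)\<^sup>-\<^sup>1 e\<close> for a basis vector \<open>e\<close>, this reads
  off an entry of \<open>u\<^sub>-\<close>, so the transposed operator need never be inverted, nor even defined:
  only the functional \<open>x \<mapsto> u\<^sub>- \<cdot> (zI - H) x\<close> occurs.\<close>

lemma left_half:
  assumes H: "is_minus p a j H" and z: "norm H < cmod z"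
    and eq: "\<And>i. i < j \<Longrightarrow>
      z * coord u i = coord u (i + 1) + (\<Sum>k=0..p. a k (i - int k) * coord u (i - int k))"
  shows "coord u (j - 1 - int n) = coord u j * coord (resolvent H z (unit n)) 0"
proof -
  \<comment> \<open>\<open>y\<close> is conjugated so that \<open>cinner _ y\<close> is the bilinear pairing with the left half of \<open>u\<close>.\<close>
  obtain y where y: "coord y = (\<lambda>n. cnj (coord u (j - 1 - int n)))"
    by (rule ell2_dominated[of "\<lambda>n. j - 1 - int n" "\<lambda>n. cnj (coord u (j - 1 - int n))" u])
       (auto simp: inj_on_def)
  have sum_left: "cinner (sum f A) y = (\<Sum>k\<in>A. cinner (f k) y)" for f :: "nat \<Rightarrow> nat ell2" and A
    using linear_sum[OF bounded_linear.linear[OF bounded_linear_cinner_left[of y]], of f A] .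
  have "cinner ((scalar_op z - H) x) y = coord u j * coord x 0" for x
  proof (rule functional_eq_on_units[where f = "\<lambda>x. cinner ((scalar_op z - H) x) y"])
    show "bounded_linear (\<lambda>x. cinner ((scalar_op z - H) x) y)"
      by (rule bounded_linear_compose[OF bounded_linear_cinner_left blinfun.bounded_linear_right])
    show "bounded_linear (\<lambda>x. coord u j * coord x 0)"
      by (intro bounded_linear_const_mult bounded_linear_coord)
    show "cinner ((scalar_op z - H) (c *\<^sub>C x)) y = c * cinner ((scalar_op z - H) x) y" for c x
    proof -
      have "(scalar_op z - H) (c *\<^sub>C x) = c *\<^sub>C (scalar_op z - H) x"
        using H by (auto intro!: ell2_eqI simp: scalar_op_minus_apply is_minus_def complex_linear_def algebra_simps)
      then show ?thesis by (simp add: cinner_scaleC_left)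
    qed
    show "cinner ((scalar_op z - H) (unit n)) y = coord u j * coord (unit n) 0" for n
    proof -
      let ?S = "\<Sum>k=0..p. a k (j - 1 - int n - int k) * coord u (j - 1 - int n - int k)"
      have "cinner (H (unit n)) y = (if n = 0 then 0 else coord u (j - int n)) + ?S"
      proof -
        have "cinner (if n = 0 then 0 else unit (n - 1)) y = (if n = 0 then 0 else coord u (j - int n))"
          by (auto simp: cinner_unit_left y of_nat_diff) (simp add: cinner_def)
        moreover have "cinner (\<Sum>k=0..p. a k (j - 1 - int n - int k) *\<^sub>C unit (n + k)) y = ?S"
          by (simp add: sum_left cinner_scaleC_left cinner_unit_left y algebra_simps)
        ultimately show ?thesis
          by (simp only: minus_column[OF H] cinner_add_left)
      qed
      moreover have "cinner ((scalar_op z - H) (unit n)) y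
          = z * coord u (j - 1 - int n) - cinner (H (unit n)) y"
        using linear_diff[OF bounded_linear.linear[OF bounded_linear_cinner_left[of y]]]
        by (simp add: scalar_op_minus_apply cinner_scaleC_left cinner_unit_left y)
      ultimately show ?thesis
        using eq[of "j - 1 - int n"] by (auto simp: coord_unit)
    qed
  qed (simp add: algebra_simps)
  from this[of "resolvent H z (unit n)"] show ?thesis
    by (simp add: resolvent_inverse[OF z] cinner_unit_left y)
qed

text \<open>The right half of \<open>u\<close> solves \<open>(zI - H) y = f\<close>, where \<open>f\<close> collects the terms by which
  the entries of \<open>u\<close> at \<open>j\<close> and to its left reach rows beyond \<open>j\<close>: the diagonal \<open>a l\<close> carries
  \<open>u\<^bsub>j-k\<^esub>\<close> to row \<open>j + l - k\<close>, which is the basis vector with index \<open>l - k - 1\<close> when counting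
  from zero.\<close>

lemma right_half:
  assumes H: "is_plus p a j H" and z: "norm H < cmod z"
    and eq: "\<And>i. j < i \<Longrightarrow>
      z * coord u i = coord u (i + 1) + (\<Sum>k=0..p. a k (i - int k) * coord u (i - int k))"
  shows "coord u (j + 1) = (\<Sum>l=1..p. \<Sum>k<l. a l (j - int k) * coord u (j - int k)
    * coord (resolvent H z (unit (l - k - 1))) 0)"
proof -
  obtain y where y: "coord y = (\<lambda>n. coord u (j + 1 + int n))"
    by (rule ell2_dominated[of "\<lambda>n. j + 1 + int n" "\<lambda>n. coord u (j + 1 + int n)" u])
       (auto simp: inj_on_def)
  define f where "f = (\<Sum>l=1..p. \<Sum>k<l. (a l (j - int k) * coord u (j - int k)) *\<^sub>C unit (l - k - 1) :: nat ell2)"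
  have "(scalar_op z - H) y = f"
  proof (rule ell2_eqI)
    fix i
    let ?t = "\<lambda>l. a l (j + 1 + int i - int l) * coord u (j + 1 + int i - int l)"
    have "coord f i = (\<Sum>l=1..p. if l \<le> i then 0 else ?t l)"
      unfolding f_def coord_sum
    proof (rule sum.cong)
      fix l
      \<comment> \<open>Diagonal \<open>l\<close> meets row \<open>i\<close> only for \<open>k = l - i - 1\<close>; for \<open>l \<le> i\<close> the
        truncated difference is a valid index, but its term vanishes.\<close>
      have "(\<Sum>k<l. coord ((a l (j - int k) * coord u (j - int k)) *\<^sub>C unit (l - k - 1)) i)
          = (\<Sum>k<l. if k = l - i - 1 then (if l \<le> i then 0 else ?t l) else 0)"
        by (intro sum.cong) (auto simp: coord_unit of_nat_diff algebra_simps)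
      also have "\<dots> = (if l \<le> i then 0 else ?t l)"
        by (auto simp: sum.delta)
      finally show "(\<Sum>k<l. coord ((a l (j - int k) * coord u (j - int k)) *\<^sub>C unit (l - k - 1)) i)
          = (if l \<le> i then 0 else ?t l)" .
    qed simp
    also have "\<dots> = (\<Sum>l=0..p. if l \<le> i then 0 else ?t l)"
      by (rule sum.mono_neutral_left) auto
    finally have f: "coord f i = (\<Sum>l=0..p. if l \<le> i then 0 else ?t l)" .
    have "(\<Sum>l=0..p. ?t l) = (\<Sum>l=0..p. if l \<le> i then ?t l else 0) + coord f i"
      unfolding f sum.distrib[symmetric] by (rule sum.cong) auto
    moreover have "(\<Sum>l=0..p. if l \<le> i then ?t l else 0)
        = (\<Sum>l=0..p. if l \<le> i then a l (j + 1 + int i - int l) * coord y (i - l) else 0)"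
      by (rule sum.cong) (auto simp: y of_nat_diff algebra_simps)
    moreover have "z * coord y i = coord y (i + 1) + (\<Sum>l=0..p. ?t l)"
      using eq[of "j + 1 + int i"] by (simp add: y add_ac)
    ultimately show "coord ((scalar_op z - H) y) i = coord f i"
      by (simp add: scalar_op_minus_apply plus_row[OF H])
  qed
  then have "y = resolvent H z f"
    using resolvent_inverse(2)[OF z, of y] by simp
  then have "coord y 0 = coord (resolvent H z f) 0" by simp
  then show ?thesis
    using H by (simp add: y f_def blinfun.sum_right resolvent_scaleC[OF z] is_plus_def)
qed

section \<open>The scalar equation for the diagonal entry\<close>

theorem lemma4p1:
  fixes p :: nat and a :: "nat \<Rightarrow> int \<Rightarrow> complex"
  assumes "p \<ge> 1" and "\<forall>k\<le>p. bounded (range (a k))"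
  shows "\<forall>(j::int) (z::complex). cmod z > norm (two_sided_op p a) \<longrightarrow>
    w_denom p a j z \<noteq> 0 \<and>
    w_fun p a j z = cinner (resolvent (two_sided_op p a) z (unit j)) (unit j)"
proof (intro allI impI)
  fix j z
  define M where "M = two_sided_op p a"
  assume "cmod z > norm (two_sided_op p a)"
  then have z: "norm M < cmod z" by (simp add: M_def)
  have M: "is_two_sided p a M" unfolding M_def by (rule two_sided_op[OF assms(2)])
  note P = plus_op[OF assms(2), of j] and N = minus_op[OF assms(2), of j]
  have zP: "norm (plus_op p a j) < cmod z" and zN: "norm (minus_op p a j) < cmod z"
    using norm_plus_le[OF M P] norm_minus_le[OF M N] z by simp_all
  define u where "u = resolvent M z (unit j)"
  have row: "z * coord u i = coord u (i + 1) + (\<Sum>k=0..p. a k (i - int k) * coord u (i - int k))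
      + (if i = j then 1 else 0)" for i
  proof -
    have "coord ((scalar_op z - M) u) i = (if i = j then 1 else 0)"
      by (simp add: u_def resolvent_inverse[OF z] coord_unit)
    then show ?thesis
      by (simp add: scalar_op_minus_apply two_sided_row[OF M] diff_eq_eq)
  qed
  have left: "coord u (j - int k) = coord u j * phi_minus p a j k z" for k
  proof (cases k)
    case (Suc n)
    then show ?thesis
      using left_half[OF N zN, of u n] row by (simp add: phi_minus_def basis_def cinner_unit algebra_simps)
  qed (simp add: phi_minus_def)
  have "coord u (j + 1) = (\<Sum>l=1..p. \<Sum>k<l. a l (j - int k) * coord u (j - int k)
      * coord (resolvent (plus_op p a j) z (unit (l - k - 1))) 0)"
    using row by (intro right_half[OF P zP]) simp
  also have "\<dots> = (\<Sum>l=1..p. \<Sum>k<l. a l (j - int k) * coord u (j - int k) * phi_plus p a j (l - k) z)"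
    by (intro sum.cong) (auto simp: phi_plus_def basis_def cinner_unit)
  finally have right: "coord u (j + 1)
      = (\<Sum>l=1..p. \<Sum>k<l. a l (j - int k) * coord u (j - int k) * phi_plus p a j (l - k) z)" .
  define S where "S = (\<Sum>l=1..p. \<Sum>k=0..l. a l (j - int k) * phi_plus p a j (l - k) z * phi_minus p a j k z)"
  \<comment> \<open>The terms \<open>k = l\<close> of the double sum come from row \<open>j\<close> of \<open>M\<close> itself, the others from \<open>u\<^bsub>j+1\<^esub>\<close>.\<close>
  have "coord u j * S = (\<Sum>l=1..p. \<Sum>k=0..l. a l (j - int k) * coord u (j - int k) * phi_plus p a j (l - k) z)"
    unfolding S_def left by (simp add: sum_distrib_left mult_ac)
  also have "\<dots> = (\<Sum>l=1..p. (\<Sum>k<l. a l (j - int k) * coord u (j - int k) * phi_plus p a j (l - k) z)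
      + a l (j - int l) * coord u (j - int l))"
    by (simp add: atMost_atLeast0[symmetric] lessThan_Suc_atMost[symmetric] phi_plus_def)
  also have "\<dots> = coord u (j + 1) + (\<Sum>l=1..p. a l (j - int l) * coord u (j - int l))"
    by (simp only: sum.distrib right)
  finally have S: "coord u j * S = coord u (j + 1) + (\<Sum>l=1..p. a l (j - int l) * coord u (j - int l))" .
  have "z * coord u j = a 0 j * coord u j + coord u j * S + 1"
    using row[of j] S by (simp add: sum.atLeast_Suc_atMost[of 0 p])
  then have "coord u j * w_denom p a j z = 1"
    unfolding w_denom_def S_def[symmetric] by (simp add: algebra_simps)
  moreover from this have "w_denom p a j z \<noteq> 0" by auto
  ultimately show "w_denom p a j z \<noteq> 0 \<and>
      w_fun p a j z = cinner (resolvent (two_sided_op p a) z (unit j)) (unit j)"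
    by (simp add: w_fun_def cinner_unit u_def M_def field_simps)
qed

end
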